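(* Let $\mathcal{C}$ be a circle representation for a graph $G$ such that $\psi_r(\mathcal{C}) = \psi(G) = k$. Then $\mathcal{C}$ contains an independent set in series of size $k-1$. Furthermore, a set of $k$ corners $\tau_0, \ldots, \tau_{k-1}$ (in clockwise order) can be added to $\mathcal{C}$ such that all chords of $\mathcal{C}$ are satisfied and, letting $c_i$ denote the chord whose endpoint on side $s_i$ is close to $\tau_i$ for each $0 \le i \le k-1$: (1) $c_i$ is in $\tau_i$ for all $1 \le i \le k-1$; and (2) one of the following holds: (a) $c_0$ is in $\tau_0$ and $c_0, \ldots, c_{k-1}$ form a $k$-independent set in series; or (b) $c_1, \ldots, c_{k-1}$ form a $(k-1)$-independent set in series, and if $k>2$ then every chord in $\tau_0$ intersects $c_1$ and does not intersect $c_{k-1}$, while if $k=2$ then $G$ is a clique.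
   Context: A circle representation of a graph $G$ is a set of chords of a circle, one per vertex, with all endpoints distinct, such that two vertices are adjacent iff their chords intersect. Corners are points of the circle distinct from chord endpoints; a chord is satisfied by a set of corners if each of the two open arcs determined by its endpoints contains a corner. $\psi_r(\mathcal{C})$ is the minimum number of corners that must be added to $\mathcal{C}$ to satisfy all its chords. A circle representation with $k$ satisfying corners is a $k$-polygon representation ($k\ge 2$; for $k=2$ a permutation representation); $\psi(G)$ is the minimum $k\ge2$ such that $G$ has a $k$-polygon representation. Given corners $\tau_0,\dots,\tau_{k-1}$ in clockwise order, side $s_i$ is the open arc from $\tau_i$ clockwise to $\tau_{i+1}$ (indices mod $k$), so $s_{i-1}$ and $s_i$ meet at $\tau_i$. A chord is in corner $\tau_i$ if its endpoints lie on the two sides $s_{i-1}$ and $s_i$ (for $k=2$ every chord is in both corners). A chord endpoint $e$ lying on a side meeting at $\tau$ is close to $\tau$ if no other chord endpoint on that side lies between $\tau$ and $e$. A sequence $c_0, \ldots, c_{\ell-1}$ of $\ell \ge 1$ chords is an $\ell$-independent set in series (an independent set in series of size $\ell$) if there is a point $x$ on the circle such that, in a clockwise traversal of the circle starting at $x$ and ending just before returning to $x$, both endpoints of $c_i$ are encountered before both endpoints of $c_{i+1}$ for all $0 \le i < \ell-1$. *)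

theory Defs
  imports "HOL-Analysis.Analysis" "Graph_Theory.Kuratowski"
begin

text \<open>
  The circle is the unit circle of the complex plane. A chord is encoded by the set of its two
  endpoints; the line segment itself is the convex hull of that set. Finite simple graphs are the
  symmetric loop-free pair digraphs of \<^locale>\<open>pair_graph\<close>.
\<close>

abbreviation circle :: "complex set" where
  "circle \<equiv> sphere 0 1"

text \<open>
  For \<open>a = cis \<alpha>\<close> and \<open>b = cis \<beta>\<close>, the quotient \<open>a / b\<close> is \<open>cis (\<alpha> - \<beta>)\<close>, so this is the angle in
  \<open>[0, 2 * pi)\<close> swept when moving \<^emph>\<open>clockwise\<close> from \<open>a\<close> to \<open>b\<close>.
\<close>
definition cw_angle :: "complex \<Rightarrow> complex \<Rightarrow> real" where
  "cw_angle a b = Arg2pi (a / b)"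

text \<open>The open arc from \<open>a\<close> clockwise to \<open>b\<close>, for distinct \<open>a\<close> and \<open>b\<close> on the circle.\<close>
definition open_arc :: "complex \<Rightarrow> complex \<Rightarrow> complex set" where
  "open_arc a b = {z \<in> circle. 0 < cw_angle a z \<and> cw_angle a z < cw_angle a b}"

definition is_chord :: "complex set \<Rightarrow> bool" where
  "is_chord c \<longleftrightarrow> c \<subseteq> circle \<and> card c = 2"

definition chords_intersect :: "complex set \<Rightarrow> complex set \<Rightarrow> bool" where
  "chords_intersect c d \<longleftrightarrow> convex hull c \<inter> convex hull d \<noteq> {}"

definition circle_representation :: "complex set set \<Rightarrow> 'v pair_pre_digraph \<Rightarrow> bool" where
  "circle_representation C G \<longleftrightarrow>
     (\<forall>c\<in>C. is_chord c) \<and> disjoint C \<and>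
     (\<exists>f. bij_betw f (pverts G) C \<and>
       (\<forall>u\<in>pverts G. \<forall>v\<in>pverts G. u \<noteq> v \<longrightarrow>
          ((u, v) \<in> parcs G \<longleftrightarrow> chords_intersect (f u) (f v))))"

text \<open>
  Both orders of the two endpoints are quantified over, so both open arcs determined by the chord
  are required to contain a corner.
\<close>
definition satisfied :: "complex set \<Rightarrow> complex set \<Rightarrow> bool" where
  "satisfied S c \<longleftrightarrow> (\<forall>p\<in>c. \<forall>q\<in>c. p \<noteq> q \<longrightarrow> S \<inter> open_arc p q \<noteq> {})"

definition satisfying_corners :: "complex set set \<Rightarrow> complex set \<Rightarrow> bool" where
  "satisfying_corners C S \<longleftrightarrow>
     finite S \<and> S \<subseteq> circle \<and> S \<inter> \<Union>C = {} \<and> (\<forall>c\<in>C. satisfied S c)"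

definition psi_r :: "complex set set \<Rightarrow> nat" where
  "psi_r C = (LEAST k. \<exists>S. satisfying_corners C S \<and> card S = k)"

definition polygon_representation ::
    "nat \<Rightarrow> complex set set \<Rightarrow> complex set \<Rightarrow> 'v pair_pre_digraph \<Rightarrow> bool" where
  "polygon_representation k C S G \<longleftrightarrow>
     2 \<le> k \<and> circle_representation C G \<and> satisfying_corners C S \<and> card S = k"

definition psi :: "'v pair_pre_digraph \<Rightarrow> nat" where
  "psi G = (LEAST k. 2 \<le> k \<and> (\<exists>C S. polygon_representation k C S G))"

text \<open>Corners \<open>\<tau> 0, \<dots>, \<tau> (k - 1)\<close> in clockwise order; in particular they are distinct.\<close>
definition clockwise_corners :: "nat \<Rightarrow> (nat \<Rightarrow> complex) \<Rightarrow> bool" where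
  "clockwise_corners k \<tau> \<longleftrightarrow>
     \<tau> ` {..<k} \<subseteq> circle \<and> (\<forall>i j. i < j \<and> j < k \<longrightarrow> cw_angle (\<tau> 0) (\<tau> i) < cw_angle (\<tau> 0) (\<tau> j))"

definition side :: "nat \<Rightarrow> (nat \<Rightarrow> complex) \<Rightarrow> nat \<Rightarrow> complex set" where
  "side k \<tau> i = open_arc (\<tau> (i mod k)) (\<tau> ((i + 1) mod k))"

text \<open>The index \<open>i + k - 1\<close> is \<open>i - 1\<close> modulo \<open>k\<close> without truncation at \<open>0\<close>.\<close>
definition in_corner :: "nat \<Rightarrow> (nat \<Rightarrow> complex) \<Rightarrow> nat \<Rightarrow> complex set \<Rightarrow> bool" where
  "in_corner k \<tau> i c \<longleftrightarrow>
     (\<exists>p q. c = {p, q} \<and> p \<in> side k \<tau> (i + k - 1) \<and> q \<in> side k \<tau> i)"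

text \<open>
  The endpoint \<open>e\<close> lies on the side running clockwise from \<open>a\<close> to \<open>b\<close> and is close to the corner \<open>t\<close>,
  which is one of the two ends of that side.
\<close>
definition close_on_side ::
    "complex set set \<Rightarrow> complex \<Rightarrow> complex \<Rightarrow> complex \<Rightarrow> complex \<Rightarrow> bool" where
  "close_on_side C a b t e \<longleftrightarrow>
     e \<in> \<Union>C \<and> e \<in> open_arc a b \<and>
     (t = a \<and> \<Union>C \<inter> open_arc a e = {} \<or> t = b \<and> \<Union>C \<inter> open_arc e b = {})"

definition close_chord ::
    "complex set set \<Rightarrow> nat \<Rightarrow> (nat \<Rightarrow> complex) \<Rightarrow> nat \<Rightarrow> complex set \<Rightarrow> bool" where
  "close_chord C k \<tau> i c \<longleftrightarrow>
     c \<in> C \<and> (\<exists>e\<in>c. close_on_side C (\<tau> (i mod k)) (\<tau> ((i + 1) mod k)) (\<tau> (i mod k)) e)"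

definition independent_in_series :: "complex set list \<Rightarrow> bool" where
  "independent_in_series cs \<longleftrightarrow>
     cs \<noteq> [] \<and>
     (\<exists>x\<in>circle. \<forall>i. Suc i < length cs \<longrightarrow>
        (\<forall>p \<in> cs ! i. \<forall>q \<in> cs ! Suc i. cw_angle x p < cw_angle x q))"

end

theory Submission
  imports Defs
begin

text \<open>
  Lift the circle to the real line and let \<open>nxt y\<close> be the first point at which a chord both of whose
  endpoints lie after \<open>y\<close> is completed. Iterating \<open>nxt\<close> and putting a corner just before every point
  reached yields chords in series, each in its corner. A set of \<open>k = psi_r C\<close> corners forces
  \<open>k\<close> iterations started at one of them to run through at least a full turn. If from some point
  they also take at most a full turn, then monotonicity of \<open>nxt\<close> yields an orbit closing up after
  exactly one turn, which is alternative (a). Otherwise no \<open>k\<close> chords are in series, every greedy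
  placement uses exactly \<open>k\<close> corners, and (b) holds for each of them: a chord in \<open>\<tau> 0\<close> violating (b)
  would extend \<open>c 1, \<dots>, c (k - 1)\<close> to \<open>k\<close> chords in series, and for \<open>k = 2\<close> two disjoint
  chords are themselves in series.
\<close>

section \<open>Lifting the circle to the real line\<close>

text \<open>The sign makes increasing parameters run clockwise, so that clockwise angles below a
  full turn become differences of reals.\<close>

definition pt :: "real \<Rightarrow> complex" where
  "pt t = cis (- t)"

lemma norm_pt [simp]: "norm (pt t) = 1"
  by (simp add: pt_def)

lemma pt_add_2pi [simp]: "pt (t + 2 * pi) = pt t"
proof -
  have "pt (t + 2 * pi) = cis (- t) * cis (- (2 * pi))"
    by (simp add: pt_def cis_mult)
  also have "cis (- (2 * pi)) = 1"
    by (simp add: complex_eq_iff)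
  finally show ?thesis by (simp add: pt_def)
qed

lemma pt_diff_2pi [simp]: "pt (t - 2 * pi) = pt t"
  using pt_add_2pi[of "t - 2 * pi"] by simp

lemma cw_angle_pt:
  assumes "s \<le> t" "t < s + 2 * pi"
  shows "cw_angle (pt s) (pt t) = t - s"
proof -
  have "pt s / pt t = exp (\<i> * of_real (t - s))"
    using cis_conv_exp[of "t - s"] by (simp add: pt_def cis_divide)
  then show ?thesis
    unfolding cw_angle_def using assms by (intro Arg2pi_unique[of 1]) auto
qed

lemma pt_cw_angle:
  assumes "z \<in> circle"
  shows "pt (s + cw_angle (pt s) z) = z"
proof -
  define w where "w = pt s / z"
  have nz: "z \<noteq> 0" "norm w = 1" "z = pt s / w" "w \<noteq> 0"
    using assms by (auto simp: w_def norm_divide pt_def)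
  have "w = cis (Arg2pi w)"
    using Arg2pi[of w] nz by (simp add: is_Arg_def cis_conv_exp)
  then have "z = pt s / cis (Arg2pi w)"
    using nz by simp
  also have "\<dots> = pt (s + cw_angle (pt s) z)"
    unfolding cw_angle_def w_def [symmetric] by (simp add: pt_def cis_divide)
  finally show ?thesis by simp
qed

lemma lift_circle:
  assumes "z \<in> circle"
  obtains t where "s \<le> t" "t < s + 2 * pi" "z = pt t"
proof
  show "s \<le> s + cw_angle (pt s) z" "s + cw_angle (pt s) z < s + 2 * pi"
    by (simp_all add: cw_angle_def Arg2pi_ge_0 Arg2pi_lt_2pi)
  show "z = pt (s + cw_angle (pt s) z)"
    using pt_cw_angle[OF assms] by simp
qed

lemma pt_inj:
  assumes "pt s = pt t" "x \<le> s" "s < x + 2 * pi" "x \<le> t" "t < x + 2 * pi"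
  shows "s = t"
proof -
  have "s - x = cw_angle (pt x) (pt s)" "t - x = cw_angle (pt x) (pt t)"
    using assms(2-) by (simp_all add: cw_angle_pt)
  then have "s - x = t - x"
    by (simp only: assms(1))
  then show ?thesis by simp
qed

lemma inj_on_pt: "inj_on pt {x..<x + 2 * pi}"
  by (intro inj_onI pt_inj[of _ _ x]) auto

text \<open>Two consecutive arcs, each shorter than a turn, stay below \<open>4 * pi\<close> in
  total; coming back to the starting point then means exactly one turn.\<close>

lemma pt_eq_next:
  assumes "pt s = pt t" "s < t" "t < s + 4 * pi"
  shows "t = s + 2 * pi"
proof (cases "t < s + 2 * pi")
  case True
  then show ?thesis using pt_inj[of s t s] assms by simp
next
  case False
  then show ?thesis
    using pt_inj[of s "t - 2 * pi" s] assms by simp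
qed

lemma pt_in_open_arc:
  assumes "a < t" "t < b" "b < a + 2 * pi"
  shows "pt t \<in> open_arc (pt a) (pt b)"
  using assms by (simp add: open_arc_def cw_angle_pt)

lemma open_arc_pt:
  assumes "a < b" "b < a + 2 * pi"
  shows "open_arc (pt a) (pt b) = pt ` {a<..<b}"
proof
  show "open_arc (pt a) (pt b) \<subseteq> pt ` {a<..<b}"
  proof
    fix z assume z: "z \<in> open_arc (pt a) (pt b)"
    then obtain t where "a \<le> t" "t < a + 2 * pi" "z = pt t"
      using lift_circle[of z a] by (auto simp: open_arc_def)
    then show "z \<in> pt ` {a<..<b}"
      using z assms by (auto simp: open_arc_def cw_angle_pt)
  qed
qed (use assms pt_in_open_arc in auto)

text \<open>On each half-open window of length \<open>2 * pi\<close> the map \<open>pt\<close> is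
  injective, and finitely many windows cover the interval.\<close>

lemma finite_lift:
  assumes "finite X"
  shows "finite {t. a \<le> t \<and> t \<le> b \<and> pt t \<in> X}"
proof -
  have fin: "finite {t. a \<le> t \<and> t < a + 2 * pi * real n \<and> pt t \<in> X}" for n
  proof (induction n)
    case 0
    have "{t. a \<le> t \<and> t < a + 2 * pi * real 0 \<and> pt t \<in> X} = {}"
      by auto
    then show ?case by (simp only: finite.emptyI)
  next
    case (Suc n)
    define x where "x = a + 2 * pi * real n"
    have "finite {t. x \<le> t \<and> t < x + 2 * pi \<and> pt t \<in> X}"
      by (rule finite_imageD[of pt], rule finite_subset[OF _ assms])
         (auto intro!: inj_onI pt_inj[where x = x])
    then have "finite ({t. a \<le> t \<and> t < x \<and> pt t \<in> X} \<union> {t. x \<le> t \<and> t < x + 2 * pi \<and> pt t \<in> X})"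
      using Suc by (simp add: x_def)
    then show ?case
      by (rule rev_finite_subset) (auto simp: x_def algebra_simps)
  qed
  obtain n where "(b - a) / (2 * pi) < real n"
    using reals_Archimedean2 by blast
  then have "b < a + 2 * pi * real n"
    by (simp add: field_simps)
  then show ?thesis
    by (intro finite_subset[OF _ fin[of n]]) auto
qed

section \<open>Crossing chords\<close>

text \<open>
  Projecting onto the direction of the midpoint of the arc from \<open>a\<close> to \<open>b\<close> sends \<open>pt t\<close> to
  \<open>cos (t - (a + b) / 2)\<close>, which compares with \<open>cos ((b - a) / 2)\<close> according to the side of the chord
  \<open>{pt a, pt b}\<close> on which \<open>pt t\<close> lies.
\<close>

lemma cos_less_outside:
  assumes "0 < h" "h < x" "x < 2 * pi - h"
  shows "cos x < cos h"
proof (cases "x \<le> pi")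
  case True
  then show ?thesis using assms cos_monotone_0_pi[of h x] by simp
next
  case False
  then have "cos (2 * pi - x) < cos h"
    using assms by (intro cos_monotone_0_pi) auto
  then show ?thesis by simp
qed

lemma inner_pt: "pt t \<bullet> pt m = cos (t - m)"
  by (simp add: pt_def inner_complex_def cos_diff)

lemma half_angle_pt:
  assumes "m = (a + b) / 2" "h = (b - a) / 2"
  shows "pt a \<bullet> pt m = cos h" "pt b \<bullet> pt m = cos h"
proof -
  have "a - m = - h" "b - m = h"
    using assms by (simp_all add: field_simps)
  then show "pt a \<bullet> pt m = cos h" "pt b \<bullet> pt m = cos h"
    by (simp_all add: inner_pt)
qed

lemma pt_inner_less:
  assumes "a < b" "b < t" "t < a + 2 * pi" "m = (a + b) / 2" "h = (b - a) / 2"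
  shows "pt t \<bullet> pt m < cos h"
  unfolding inner_pt using assms by (intro cos_less_outside) (auto simp: field_simps)

lemma pt_inner_greater:
  assumes "a < t" "t < b" "b < a + 2 * pi" "m = (a + b) / 2" "h = (b - a) / 2"
  shows "cos h < pt t \<bullet> pt m"
proof -
  have "cos h < cos \<bar>t - m\<bar>"
    using assms by (intro cos_monotone_0_pi) (auto simp: field_simps abs_if)
  then show ?thesis by (simp add: inner_pt)
qed

text \<open>The line through \<open>pt a\<close> and \<open>pt b\<close> separates the chords: the
  projection onto \<open>pt m\<close> is at least \<open>cos h\<close> on the first and smaller on
  the second.\<close>

lemma not_chords_intersect:
  assumes "a < b" "b < c" "c < d" "d < a + 2 * pi"
  shows "\<not> chords_intersect {pt a, pt b} {pt c, pt d}"
proof -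
  define m h where "m = (a + b) / 2" and "h = (b - a) / 2"
  have "convex hull {pt a, pt b} \<subseteq> {z. pt m \<bullet> z \<ge> cos h}"
    using half_angle_pt[OF m_def h_def]
    by (intro hull_minimal convex_halfspace_ge) (auto simp: inner_commute)
  moreover have "convex hull {pt c, pt d} \<subseteq> {z. pt m \<bullet> z < cos h}"
    using pt_inner_less[OF _ _ _ m_def h_def, of c] pt_inner_less[OF _ _ _ m_def h_def, of d] assms
    by (intro hull_minimal convex_halfspace_lt) (auto simp: inner_commute)
  ultimately show ?thesis
    unfolding chords_intersect_def by fastforce
qed

text \<open>The ends of the second chord lie strictly on opposite sides of the line carrying the
  first, so it meets that line. The meeting point lies in the unit disc, hence between
  \<open>pt a\<close> and \<open>pt b\<close>.\<close>

lemma chords_intersect_crossing: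
  assumes "a < c" "c < b" "b < d" "d < a + 2 * pi"
  shows "chords_intersect {pt a, pt b} {pt c, pt d}"
proof -
  define m h where "m = (a + b) / 2" and "h = (b - a) / 2"
  define u v where "u = pt c \<bullet> pt m - cos h" and "v = cos h - pt d \<bullet> pt m"
  have pos: "u > 0" "v > 0"
    using pt_inner_greater[OF _ _ _ m_def h_def, of c] pt_inner_less[OF _ _ _ m_def h_def, of d] assms
    by (auto simp: u_def v_def)
  \<comment> \<open>The weights are chosen so that the projection of \<open>z\<close> onto
    \<open>pt m\<close> is exactly \<open>cos h\<close>.\<close>
  define z where "z = (v / (u + v)) *\<^sub>R pt c + (u / (u + v)) *\<^sub>R pt d"
  have z_hull: "z \<in> convex hull {pt c, pt d}"
  proof -
    have "v / (u + v) + u / (u + v) = 1"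
      using pos by (simp add: add_divide_distrib [symmetric] add.commute)
    then show ?thesis
      unfolding convex_hull_2 z_def using pos
      by (intro CollectI exI[of _ "v / (u + v)"] exI[of _ "u / (u + v)"] conjI refl) auto
  qed
  have "convex hull {pt c, pt d} \<subseteq> cball 0 1"
    by (intro hull_minimal convex_cball) (auto simp: pt_def)
  then have z_norm: "norm z \<le> 1"
    using z_hull by auto
  have z_inner: "z \<bullet> pt m = cos h"
  proof -
    have "z \<bullet> pt m = (v * (u + cos h) + u * (cos h - v)) / (u + v)"
      by (simp add: z_def inner_add_left u_def v_def add_divide_distrib)
    also have "\<dots> = cos h"
      using pos by (simp add: field_simps)
    finally show ?thesis .
  qed
  \<comment> \<open>Rotating \<open>pt m\<close> to \<open>1\<close> turns the first chord into the
    vertical segment from \<open>cis (- h)\<close> to \<open>cis h\<close>.\<close>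
  define w where "w = z * cis m"
  have re_w: "Re w = cos h"
    using z_inner by (simp add: w_def pt_def inner_complex_def)
  have sin_h: "sin h > 0"
    using assms by (intro sin_gt_zero) (auto simp: h_def)
  have "norm w \<le> 1"
    using z_norm by (simp add: w_def norm_mult)
  then have "(Re w)\<^sup>2 + (Im w)\<^sup>2 \<le> 1"
    by (simp add: cmod_def)
  then have "(Im w)\<^sup>2 \<le> (sin h)\<^sup>2"
    using sin_cos_squared_add[of h] by (simp only: re_w)
  then have im_w: "\<bar>Im w\<bar> \<le> sin h"
    using sin_h by (metis abs_le_square_iff abs_of_pos)
  \<comment> \<open>The range of \<open>Im w\<close>, from \<open>- sin h\<close> to
    \<open>sin h\<close>, is rescaled to the unit interval; this is the weight of
    \<open>cis h\<close>.\<close>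
  define l where "l = (1 + Im w / sin h) / 2"
  have l: "0 \<le> l" "l \<le> 1"
    using im_w sin_h by (auto simp: l_def field_simps abs_if split: if_splits)
  have "w = l *\<^sub>R cis h + (1 - l) *\<^sub>R cis (- h)"
    using sin_h by (simp add: complex_eq_iff re_w l_def field_simps)
  then have "z * cis m * cis (- m) = (l *\<^sub>R cis h + (1 - l) *\<^sub>R cis (- h)) * cis (- m)"
    by (simp only: w_def)
  also have "\<dots> = l *\<^sub>R cis (h - m) + (1 - l) *\<^sub>R cis (- h - m)"
    by (simp add: ring_distribs cis_mult)
  also have "h - m = - a"
    by (simp add: h_def m_def field_simps)
  also have "- h - m = - b"
    by (simp add: h_def m_def field_simps)
  finally have "z = l *\<^sub>R pt a + (1 - l) *\<^sub>R pt b"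
    by (simp add: pt_def cis_mult mult.assoc)
  then have "z \<in> convex hull {pt a, pt b}"
    unfolding convex_hull_2 using l by (intro CollectI exI[of _ l] exI[of _ "1 - l"]) auto
  with z_hull show ?thesis
    unfolding chords_intersect_def by auto
qed

section \<open>Chords in series\<close>

text \<open>All endpoints lift into one window of length \<open>2 * pi\<close> starting at
  \<open>y\<close>, so with \<open>pt y\<close> as starting point the order of the traversal is the
  order of the lifts.\<close>

lemma independent_in_series_pt:
  assumes "a < k"
    and c: "\<And>i. a \<le> i \<Longrightarrow> i < k \<Longrightarrow> c i = {pt (s i), pt (t i)}"
    and bounds: "\<And>i. a \<le> i \<Longrightarrow> i < k \<Longrightarrow> y \<le> s i \<and> s i < t i \<and> t i < y + 2 * pi"
    and step: "\<And>i. a \<le> i \<Longrightarrow> Suc i < k \<Longrightarrow> t i < s (Suc i)"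
  shows "independent_in_series (map c [a..<k])"
  unfolding independent_in_series_def
proof (intro conjI bexI[of _ "pt y"] allI impI ballI)
  fix i p q
  assume i: "Suc i < length (map c [a..<k])"
    and p: "p \<in> map c [a..<k] ! i" and q: "q \<in> map c [a..<k] ! Suc i"
  define j where "j = a + i"
  have j: "a \<le> j" "Suc j < k"
    using i by (auto simp: j_def)
  have "map c [a..<k] ! i = c j" "map c [a..<k] ! Suc i = c (Suc j)"
    using i by (auto simp: j_def)
  then have "p \<in> {pt (s j), pt (t j)}" "q \<in> {pt (s (Suc j)), pt (t (Suc j))}"
    using p q c[of j] c[of "Suc j"] j by auto
  then show "cw_angle (pt y) p < cw_angle (pt y) q"
    using bounds[of j] bounds[of "Suc j"] step[of j] j by (auto simp: cw_angle_pt)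
qed (use assms(1) in auto)

lemma independent_in_series_take:
  assumes "independent_in_series cs" "0 < n"
  shows "independent_in_series (take n cs)"
proof -
  obtain x where x: "x \<in> circle" "\<And>i. Suc i < length cs \<Longrightarrow>
      \<forall>p\<in>cs ! i. \<forall>q\<in>cs ! Suc i. cw_angle x p < cw_angle x q"
    using assms(1) by (auto simp: independent_in_series_def)
  show ?thesis
    unfolding independent_in_series_def
  proof (intro conjI bexI[of _ x] allI impI)
    show "take n cs \<noteq> []"
      using assms by (auto simp: independent_in_series_def)
    show "\<forall>p\<in>take n cs ! i. \<forall>q\<in>take n cs ! Suc i. cw_angle x p < cw_angle x q"
      if "Suc i < length (take n cs)" for i
      using x(2)[of i] that by simp
  qed (fact x(1))
qed

section \<open>The greedy map\<close>

locale chord_family =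
  fixes C :: "complex set set"
  assumes finite_C: "finite C"
    and C_nonempty: "C \<noteq> {}"
    and chords: "c \<in> C \<Longrightarrow> is_chord c"
    and disjoint_C: "disjoint C"
begin

definition endpt :: "real \<Rightarrow> bool" where
  "endpt t \<longleftrightarrow> pt t \<in> \<Union>C"

text \<open>Up to full turns a chord appears as two such arcs, one for each side of it, interchanged
  by \<open>arc_flip\<close>. A clockwise sweep can thus open a chord at either endpoint.\<close>

definition chord_arc :: "real \<Rightarrow> real \<Rightarrow> bool" where
  "chord_arc s t \<longleftrightarrow> s < t \<and> t < s + 2 * pi \<and> {pt s, pt t} \<in> C"

lemma arcD:
  assumes "chord_arc s t"
  shows "s < t" "t < s + 2 * pi" "{pt s, pt t} \<in> C" "endpt s" "endpt t"
  using assms by (auto simp: chord_arc_def endpt_def)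

lemma arc_flip: "chord_arc s t \<Longrightarrow> chord_arc t (s + 2 * pi)"
  by (auto simp: chord_arc_def insert_commute)

lemma arc_shift: "chord_arc s t \<Longrightarrow> chord_arc (s + 2 * pi) (t + 2 * pi)"
  by (auto simp: chord_arc_def)

lemma arc_shift': "chord_arc s t \<Longrightarrow> chord_arc (s - 2 * pi) (t - 2 * pi)"
  by (auto simp: chord_arc_def)

lemma endpt_shift [simp]: "endpt (t + 2 * pi) = endpt t" "endpt (t - 2 * pi) = endpt t"
  by (auto simp: endpt_def)

lemma finite_endpoints: "finite (\<Union>C)"
proof (rule finite_Union[OF finite_C])
  fix c assume "c \<in> C"
  then have "card c = 2"
    using chords by (auto simp: is_chord_def)
  then show "finite c"
    by (intro card_ge_0_finite) simp
qed

lemma finite_endpts: "finite {t. a \<le> t \<and> t \<le> b \<and> endpt t}"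
  unfolding endpt_def by (rule finite_lift[OF finite_endpoints])

lemma chord_eqI:
  assumes "c \<in> C" "d \<in> C" "z \<in> c" "z \<in> d"
  shows "c = d"
  using disjoint_C assms by (auto simp: disjoint_def)

text \<open>By disjointness an endpoint determines its chord, so the second arc belongs to the same
  chord and leads back to the start.\<close>

lemma arc_arc:
  assumes "chord_arc s t" "chord_arc t u"
  shows "u = s + 2 * pi"
proof -
  have "{pt s, pt t} = {pt t, pt u}"
    using assms by (intro chord_eqI[of _ _ "pt t"]) (auto simp: chord_arc_def)
  then have "pt s = pt u"
    by (auto simp: doubleton_eq_iff)
  then show ?thesis
    using assms by (intro pt_eq_next) (auto simp: chord_arc_def)
qed

lemma chord_lift:
  assumes "c \<in> C" "\<not> endpt x"
  obtains s t where "x < s" "s < t" "t < x + 2 * pi" "c = {pt s, pt t}" "chord_arc s t"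
proof -
  obtain p q where pq: "c = {p, q}" "p \<noteq> q" "p \<in> circle" "q \<in> circle"
    using chords[OF assms(1)] by (auto simp: is_chord_def card_2_iff)
  obtain s where s: "x \<le> s" "s < x + 2 * pi" "p = pt s"
    using lift_circle[OF pq(3)] by metis
  obtain t where t: "x \<le> t" "t < x + 2 * pi" "q = pt t"
    using lift_circle[OF pq(4)] by metis
  have "x \<noteq> s" "x \<noteq> t" "s \<noteq> t"
    using assms pq s t by (auto simp: endpt_def)
  then show ?thesis
    using that[of s t] that[of t s] assms(1) pq(1) s t
    by (cases "s < t") (auto simp: chord_arc_def insert_commute)
qed

lemma ex_arc_from:
  assumes "endpt s"
  obtains t where "chord_arc s t"
proof -
  obtain c where c: "c \<in> C" "pt s \<in> c"
    using assms by (auto simp: endpt_def)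
  obtain p q where pq: "c = {p, q}" "p \<noteq> q" "p \<in> circle" "q \<in> circle"
    using chords[OF c(1)] by (auto simp: is_chord_def card_2_iff)
  obtain z where z: "c = {pt s, z}" "z \<noteq> pt s" "z \<in> circle"
    using c pq by auto
  obtain t where t: "s \<le> t" "t < s + 2 * pi" "z = pt t"
    using lift_circle[OF z(3)] by metis
  then have "s \<noteq> t"
    using z by auto
  then show ?thesis
    using that[of t] t c z by (auto simp: chord_arc_def)
qed

lemma ex_endpt: obtains e where "endpt e"
proof -
  obtain c where "c \<in> C"
    using C_nonempty by auto
  then obtain p where p: "p \<in> c" "p \<in> circle"
    using chords by (force simp: is_chord_def card_2_iff)
  then obtain e where "p = pt e"
    using lift_circle by metis
  then show ?thesis
    using that[of e] p \<open>c \<in> C\<close> by (auto simp: endpt_def)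
qed

section \<open>A uniform gap between lifted endpoints\<close>

text \<open>Moving back by this amount from an endpoint meets no other endpoint and lands on a point
  where a corner may be placed.\<close>

definition eps :: real where
  "eps = (SOME d. 0 < d \<and> d < 2 * pi \<and> (\<forall>u e. endpt u \<longrightarrow> endpt e \<longrightarrow> u < e \<longrightarrow> u < e - d))"

text \<open>Up to full turns only finitely many distances below \<open>2 * pi\<close> occur between
  endpoints; half of a positive lower bound for them is strictly smaller than each.\<close>

lemma ex_eps: "\<exists>d>0. d < 2 * pi \<and> (\<forall>u e. endpt u \<longrightarrow> endpt e \<longrightarrow> u < e \<longrightarrow> u < e - d)"
proof -
  \<comment> \<open>One endpoint of a pair is moved into the first turn; its partner, less than a
    turn later, then lies below \<open>4 * pi\<close>. Inserting \<open>2 * pi\<close> into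
    \<open>D\<close> keeps \<open>D\<close> nonempty and half its minimum below a turn.\<close>
  define A where "A = {t. 0 \<le> t \<and> t \<le> 4 * pi \<and> endpt t}"
  define D where "D = insert (2 * pi) ((\<lambda>p. snd p - fst p) ` {p \<in> A \<times> A. fst p < snd p})"
  have "finite A"
    unfolding A_def by (rule finite_endpts)
  then have fin: "finite D"
    by (simp add: D_def)
  have pos: "Min D > 0"
    using fin by (subst Min_gr_iff) (auto simp: D_def)
  have close: "Min D \<le> e - u" if "endpt u" "endpt e" "u < e" "e < u + 2 * pi" for u e
  proof -
    obtain u' where u': "0 \<le> u'" "u' < 0 + 2 * pi" "pt u = pt u'"
      using lift_circle[of "pt u" 0] by auto
    obtain e' where e': "u' \<le> e'" "e' < u' + 2 * pi" "pt e = pt e'"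
      using lift_circle[of "pt e" u'] by auto
    have "e - u = cw_angle (pt u) (pt e)"
      using that by (simp add: cw_angle_pt)
    also have "\<dots> = cw_angle (pt u') (pt e')"
      by (simp only: u'(3) e'(3))
    also have "\<dots> = e' - u'"
      using e' by (intro cw_angle_pt)
    finally have "e - u = e' - u'" .
    moreover have "u' \<in> A" "e' \<in> A"
      using u' e' that(1,2) unfolding A_def endpt_def by auto
    then have "e' - u' \<in> D"
      using that(3) \<open>e - u = e' - u'\<close>
      by (auto simp: D_def intro!: image_eqI[of _ _ "(u', e')"])
    ultimately show ?thesis
      using fin by simp
  qed
  have "Min D \<le> 2 * pi"
    using fin by (simp add: D_def)
  show ?thesis
  proof (intro exI[of _ "Min D / 2"] conjI allI impI)
    fix u e assume "endpt u" "endpt e" "u < e"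
    then show "u < e - Min D / 2"
      using close[of u e] pos \<open>Min D \<le> 2 * pi\<close> pi_gt_zero by (cases "e < u + 2 * pi") auto
  next
    show "0 < Min D / 2"
      using pos by simp
    show "Min D / 2 < 2 * pi"
      using \<open>Min D \<le> 2 * pi\<close> pi_gt_zero by linarith
  qed
qed

lemma eps_pos: "0 < eps"
  and eps_less: "eps < 2 * pi"
  and eps_gap: "endpt u \<Longrightarrow> endpt e \<Longrightarrow> u < e \<Longrightarrow> u < e - eps"
  using someI_ex[OF ex_eps] unfolding eps_def[symmetric] by blast+

lemma not_endpt_before: "endpt e \<Longrightarrow> \<not> endpt (e - eps)"
  using eps_gap[of "e - eps" e] eps_pos by auto

lemma endpt_ge: "endpt u \<Longrightarrow> endpt e \<Longrightarrow> e - eps \<le> u \<Longrightarrow> e \<le> u"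
  using eps_gap[of u e] by force

section \<open>The least completion point and its iterates\<close>

definition nxt :: "real \<Rightarrow> real" where
  "nxt y = (LEAST t. \<exists>s. y < s \<and> chord_arc s t)"

text \<open>The \<open>LEAST\<close> over the reals is attained: some arc starts after
  \<open>y\<close>, and only finitely many endpoints lie between \<open>y\<close> and its
  end.\<close>

lemma nxt_least: "(\<exists>s. y < s \<and> chord_arc s (nxt y)) \<and> (\<forall>s t. y < s \<longrightarrow> chord_arc s t \<longrightarrow> nxt y \<le> t)"
proof -
  define A where "A = {t. \<exists>s. y < s \<and> chord_arc s t}"
  obtain e where e: "endpt e"
    by (rule ex_endpt)
  obtain s where s: "y + pi \<le> s" "pt e = pt s"
    using lift_circle[of "pt e" "y + pi"] by auto
  then have "y < s"
    using pi_gt_zero by linarith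
  moreover obtain t where "chord_arc s t"
    using ex_arc_from[of s] e s by (auto simp: endpt_def)
  ultimately have t: "t \<in> A"
    by (auto simp: A_def)
  define F where "F = {u \<in> A. u \<le> t}"
  have fin: "finite F"
    by (rule finite_subset[OF _ finite_endpts[of y t]]) (auto simp: F_def A_def dest: arcD)
  have "F \<noteq> {}"
    using t by (auto simp: F_def)
  then have "Min F \<in> F"
    using Min_in[OF fin] by simp
  then have min_A: "Min F \<in> A" and min_t: "Min F \<le> t"
    by (simp_all add: F_def)
  have min_le: "Min F \<le> u" if "u \<in> A" for u
    using Min_le[OF fin, of u] min_t that by (cases "u \<le> t") (auto simp: F_def)
  then have "nxt y = Min F"
    unfolding nxt_def using min_A min_le by (intro Least_equality) (auto simp: A_def)
  then show ?thesis
    using min_A min_le by (auto simp: A_def)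
qed

lemma nxt_arc:
  obtains s where "y < s" "chord_arc s (nxt y)"
  using nxt_least[of y] by blast

lemma nxt_le: "y < s \<Longrightarrow> chord_arc s t \<Longrightarrow> nxt y \<le> t"
  using nxt_least[of y] by blast

lemma nxt_greater: "y < nxt y"
  by (rule nxt_arc[of y]) (auto dest: arcD(1))

lemma endpt_nxt [simp]: "endpt (nxt y)"
  by (rule nxt_arc[of y]) (auto dest: arcD(5))

lemma nxt_mono: "x \<le> y \<Longrightarrow> nxt x \<le> nxt y"
  by (rule nxt_arc[of y]) (auto intro: nxt_le order.strict_trans1)

definition orbit :: "real \<Rightarrow> nat \<Rightarrow> real" where
  "orbit y n = (nxt ^^ n) y"

lemma orbit_0 [simp]: "orbit y 0 = y"
  and orbit_Suc [simp]: "orbit y (Suc n) = nxt (orbit y n)"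
  by (simp_all add: orbit_def)

lemma orbit_strict_mono: "i < j \<Longrightarrow> orbit y i < orbit y j"
  by (rule lift_Suc_mono_less[of "orbit y"]) (simp_all add: nxt_greater)

lemma orbit_mono: "i \<le> j \<Longrightarrow> orbit y i \<le> orbit y j"
  using orbit_strict_mono[of i j y] by (cases "i = j") auto

lemma orbit_mono_start: "x \<le> y \<Longrightarrow> orbit x n \<le> orbit y n"
  by (induction n) (auto intro: nxt_mono)

lemma endpt_orbit: "0 < n \<Longrightarrow> endpt (orbit y n)"
  by (cases n) auto

lemma orbit_add: "orbit y (m + n) = orbit (orbit y m) n"
  by (induction n) auto

lemma orbit_arc:
  obtains s where "orbit y i < s" "chord_arc s (orbit y (Suc i))"
  using nxt_arc[of "orbit y i"] by auto

text \<open>From index 1 on, an orbit consists of strictly increasing endpoints, and a bounded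
  interval contains only finitely many of those.\<close>

lemma orbit_exceeds: "\<exists>j. orbit x j < b \<and> b \<le> orbit x (Suc j)" if "x < b"
proof -
  have "\<exists>j. b \<le> orbit x j"
  proof (rule ccontr)
    assume "\<not> ?thesis"
    then have "orbit x n \<le> b" for n
      by (meson le_cases)
    moreover have "x \<le> orbit x n" for n
      using orbit_mono[of 0 n x] by simp
    moreover have "endpt (orbit x (Suc n))" for n
      by (simp add: endpt_orbit)
    ultimately have "range (\<lambda>n. orbit x (Suc n)) \<subseteq> {t. x \<le> t \<and> t \<le> b \<and> endpt t}"
      by blast
    moreover have "inj (\<lambda>n. orbit x (Suc n))"
      by (intro strict_mono_imp_inj_on strict_monoI orbit_strict_mono) simp
    ultimately show False
      using finite_endpts finite_subset range_inj_infinite by blast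
  qed
  then have "b \<le> orbit x (LEAST j. b \<le> orbit x j)"
    by (rule LeastI_ex)
  moreover have "(LEAST j. b \<le> orbit x j) \<noteq> 0"
    using calculation that by (metis not_le orbit_0)
  then obtain j where "(LEAST j. b \<le> orbit x j) = Suc j"
    using not0_implies_Suc by blast
  ultimately show ?thesis
    using not_less_Least[of j "\<lambda>j. b \<le> orbit x j"] by (metis lessI not_le)
qed

text \<open>A fixed point argument in the style of Knaster and Tarski: \<open>g\<close> is monotone,
  moves \<open>x\<close> up and \<open>y\<close> down, and maps the finite set \<open>A\<close> into
  itself, so it fixes a minimal element of \<open>A\<close>.\<close>

lemma periodic_orbit:
  assumes "x \<le> y" "x + 2 * pi \<le> orbit x k" "orbit y k \<le> y + 2 * pi" "0 < k"
  obtains e where "endpt e" "orbit e k = e + 2 * pi"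
proof -
  define g where "g z = orbit z k - 2 * pi" for z
  define A where "A = {z. x \<le> z \<and> z \<le> y \<and> endpt z \<and> g z \<le> z}"
  have g_mono: "g z \<le> g z'" if "z \<le> z'" for z z'
    using orbit_mono_start[OF that] by (simp add: g_def)
  have g_end: "endpt (g z)" for z
    using assms(4) by (simp add: g_def endpt_orbit)
  have x: "x \<le> g x" and y: "g y \<le> y"
    using assms by (auto simp: g_def)
  have "finite A"
    by (rule finite_subset[OF _ finite_endpts[of x y]]) (auto simp: A_def)
  \<comment> \<open>The point \<open>y\<close> need not be an endpoint, but \<open>g y\<close> is
    one, which makes \<open>A\<close> nonempty.\<close>
  moreover have "g y \<in> A"
    using g_end g_mono[of x y] g_mono[of "g y" y] x y assms(1) by (auto simp: A_def)
  ultimately obtain e where e: "e \<in> A" "\<forall>z\<in>A. z \<le> e \<longrightarrow> z = e"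
    using finite_has_minimal[of A] by auto
  have "g e \<in> A"
    using g_end g_mono[of x e] g_mono[of "g e" e] x e(1) by (auto simp: A_def)
  then have "g e = e"
    using e by (auto simp: A_def)
  then show ?thesis
    using that[of e] e(1) by (simp add: A_def g_def)
qed

text \<open>Each iteration completes an arc opened after the previous orbit point, and that arc
  contains a corner. Together with \<open>x\<close> this gives \<open>j + 1\<close> corners,
  distinct because they lift into one turn.\<close>

lemma orbit_less_card:
  assumes S: "satisfying_corners C S" and x: "pt x \<in> S" and j: "orbit x j < x + 2 * pi"
  shows "j < card S"
proof -
  have "\<exists>T. T \<subseteq> {x..orbit x i} \<and> finite T \<and> card T = Suc i \<and> pt ` T \<subseteq> S" for i
  proof (induction i)
    case 0
    show ?case
      using x by (intro exI[of _ "{x}"]) auto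
  next
    case (Suc i)
    then obtain T where T: "T \<subseteq> {x..orbit x i}" "finite T" "card T = Suc i" "pt ` T \<subseteq> S"
      by blast
    obtain s where s: "orbit x i < s" "chord_arc s (orbit x (Suc i))"
      by (rule orbit_arc)
    define t where "t = orbit x (Suc i)"
    have a: "s < t" "t < s + 2 * pi" "{pt s, pt t} \<in> C"
      using arcD[OF s(2)] by (auto simp: t_def)
    then have "pt s \<noteq> pt t"
      using pt_inj[of s t s] by auto
    then have "S \<inter> open_arc (pt s) (pt t) \<noteq> {}"
      using S a(3) by (auto simp: satisfying_corners_def satisfied_def)
    then obtain u where u: "s < u" "u < t" "pt u \<in> S"
      using a by (auto simp: open_arc_pt)
    have "x \<le> orbit x i"
      using orbit_mono[of 0 i x] by simp
    have "orbit x i < u" "u \<le> orbit x (Suc i)"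
      using s(1) u by (auto simp: t_def)
    moreover have "u \<notin> T"
      using T(1) calculation(1) by auto
    moreover have "T \<subseteq> {x..orbit x (Suc i)}"
      using T(1) orbit_mono[of i "Suc i" x] by fastforce
    ultimately show ?case
      using T u(3) \<open>x \<le> orbit x i\<close> by (intro exI[of _ "insert u T"]) auto
  qed
  then obtain T where T: "T \<subseteq> {x..orbit x j}" "card T = Suc j" "pt ` T \<subseteq> S"
    by blast
  have "T \<subseteq> {x..<x + 2 * pi}"
    using T(1) j by fastforce
  then have "inj_on pt T"
    by (rule inj_on_subset[OF inj_on_pt])
  then have "card T \<le> card S"
    using T(3) S by (intro card_inj_on_le) (auto simp: satisfying_corners_def)
  then show ?thesis
    using T by simp
qed

section \<open>Corners just before a sequence of endpoints\<close>

text \<open>The last clause says that no chord has both ends in a block from \<open>e i\<close>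
  (included) to \<open>e (Suc i)\<close> (excluded). This is what lets corners just before the cuts
  satisfy every chord.\<close>

definition cuts :: "nat \<Rightarrow> (nat \<Rightarrow> real) \<Rightarrow> bool" where
  "cuts n e \<longleftrightarrow>
     (\<forall>i<n. e i < e (Suc i)) \<and> e n = e 0 + 2 * pi \<and> (\<forall>i\<le>n. endpt (e i)) \<and>
     (\<forall>i<n. \<forall>s t. chord_arc s t \<longrightarrow> e i \<le> s \<longrightarrow> e (Suc i) \<le> t)"

definition corner :: "(nat \<Rightarrow> real) \<Rightarrow> nat \<Rightarrow> complex" where
  "corner e i = pt (e i - eps)"

lemma cuts_less:
  assumes "cuts n e" "i < j" "j \<le> n"
  shows "e i < e j"
  using assms(2,3)
proof (induction j)
  case (Suc j)
  have "e j < e (Suc j)"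
    using assms(1) Suc.prems by (auto simp: cuts_def)
  then show ?case
    using Suc by (cases "i = j") auto
qed simp

lemma cuts_bounds:
  assumes "cuts n e" "i < n"
  shows "e 0 \<le> e i" "e i < e 0 + 2 * pi"
  using cuts_less[OF assms(1), of 0 i] cuts_less[OF assms(1), of i n] assms
  by (cases "i = 0"; auto simp: cuts_def)+

lemma cuts_step:
  assumes "cuts n e" "i < n" "2 \<le> n"
  shows "e i < e (Suc i)" "e (Suc i) < e i + 2 * pi"
proof -
  show "e i < e (Suc i)"
    using assms by (auto simp: cuts_def)
  show "e (Suc i) < e i + 2 * pi"
  proof (cases "Suc i < n")
    case True
    then show ?thesis
      using cuts_bounds[OF assms(1), of "Suc i"] cuts_bounds[OF assms(1,2)] by linarith
  next
    case False
    then have "Suc i = n"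
      using assms(2) by simp
    moreover have "e 0 < e i"
      using assms \<open>Suc i = n\<close> by (intro cuts_less[OF assms(1)]) auto
    ultimately show ?thesis
      using assms(1) by (auto simp: cuts_def)
  qed
qed

lemma cuts_cover:
  assumes "cuts n e" "e 0 \<le> t" "t < e 0 + 2 * pi"
  obtains i where "i < n" "e i \<le> t" "t < e (Suc i)"
proof -
  have "t < e n"
    using assms by (simp add: cuts_def)
  then have "t < e (LEAST i. t < e i)" and le: "(LEAST i. t < e i) \<le> n"
    by (auto intro: LeastI Least_le)
  moreover have "(LEAST i. t < e i) \<noteq> 0"
    using calculation(1) assms(2) by (metis not_le)
  then obtain i where i: "(LEAST i. t < e i) = Suc i"
    using not0_implies_Suc by blast
  ultimately show ?thesis
    using that[of i] not_less_Least[of i "\<lambda>i. t < e i"] by auto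
qed

text \<open>An arc starting in block \<open>i\<close> ends at \<open>e (Suc i)\<close> or later, so
  the corner just before that cut lies inside it. Either endpoint of a chord may serve as the start,
  so both of its arcs are hit.\<close>

lemma cuts_satisfying:
  assumes "cuts n e"
  shows "satisfying_corners C (corner e ` {..<n})" "card (corner e ` {..<n}) = n"
proof -
  have "inj_on (corner e) {..<n}"
  proof (rule inj_onI)
    fix i j assume ij: "i \<in> {..<n}" "j \<in> {..<n}" "corner e i = corner e j"
    then have "e i - eps = e j - eps"
      using cuts_bounds[OF assms, of i] cuts_bounds[OF assms, of j]
      by (intro pt_inj[of _ _ "e 0 - eps"]) (auto simp: corner_def)
    then show "i = j"
      using cuts_less[OF assms, of i j] cuts_less[OF assms, of j i] ij
      by (cases i j rule: linorder_cases) auto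
  qed
  then show "card (corner e ` {..<n}) = n"
    by (simp add: card_image)
  have "n \<noteq> 0"
    using assms by (auto simp: cuts_def intro!: gr0I)
  have "satisfied (corner e ` {..<n}) c" if "c \<in> C" for c
    unfolding satisfied_def
  proof (intro ballI impI)
    fix p q assume pq: "p \<in> c" "q \<in> c" "p \<noteq> q"
    have circ: "c \<subseteq> circle" "card c = 2"
      using chords[OF that] by (auto simp: is_chord_def)
    then have c: "c = {p, q}"
      using pq by (auto simp: card_2_iff)
    obtain s where s: "e 0 \<le> s" "s < e 0 + 2 * pi" "p = pt s"
      using lift_circle[of p "e 0"] pq(1) circ by blast
    obtain t where t: "s \<le> t" "t < s + 2 * pi" "q = pt t"
      using lift_circle[of q s] pq(2) circ by blast
    have "s \<noteq> t"
      using s t pq by auto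
    then have chord_arc: "chord_arc s t"
      using s t c that by (auto simp: chord_arc_def)
    obtain i where i: "i < n" "e i \<le> s" "s < e (Suc i)"
      using cuts_cover[OF assms s(1,2)] .
    have "e (Suc i) \<le> t" "endpt (e (Suc i))"
      using assms i chord_arc by (auto simp: cuts_def)
    moreover have "s < e (Suc i) - eps"
      using i calculation arcD[OF chord_arc] by (intro eps_gap) auto
    ultimately have "pt (e (Suc i) - eps) \<in> open_arc p q"
      using s t eps_pos by (auto intro!: pt_in_open_arc)
    \<comment> \<open>The corner before the last cut is \<open>corner e 0\<close>, one turn
      later.\<close>
    moreover have "pt (e (Suc i) - eps) \<in> corner e ` {..<n}"
    proof (cases "Suc i < n")
      case False
      then have "Suc i = n"
        using i by simp
      then have "pt (e (Suc i) - eps) = corner e 0"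
        using assms pt_add_2pi[of "e 0 - eps"] by (simp add: cuts_def corner_def algebra_simps)
      then show ?thesis
        using \<open>n \<noteq> 0\<close> by auto
    qed (auto simp: corner_def)
    ultimately show "corner e ` {..<n} \<inter> open_arc p q \<noteq> {}"
      by auto
  qed
  moreover have "corner e i \<notin> \<Union>C" if "i < n" for i
    using assms that not_endpt_before[of "e i"] by (auto simp: corner_def endpt_def cuts_def)
  ultimately show "satisfying_corners C (corner e ` {..<n})"
    by (auto simp: satisfying_corners_def corner_def)
qed

lemma cuts_clockwise:
  assumes "cuts n e"
  shows "clockwise_corners n (corner e)"
  unfolding clockwise_corners_def
proof (intro conjI allI impI)
  fix i j assume ij: "i < j \<and> j < n"
  then have "i < n"
    by simp
  have "cw_angle (corner e 0) (corner e m) = e m - e 0" if "m < n" for m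
    unfolding corner_def using cuts_bounds[OF assms that] by (subst cw_angle_pt) auto
  then show "cw_angle (corner e 0) (corner e i) < cw_angle (corner e 0) (corner e j)"
    using ij \<open>i < n\<close> cuts_less[OF assms, of i j] by auto
qed (auto simp: corner_def)

lemma side_corner:
  assumes "cuts n e" "2 \<le> n" "i < n"
  shows "side n (corner e) i = pt ` {e i - eps<..<e (Suc i) - eps}"
proof -
  have "corner e ((i + 1) mod n) = pt (e (Suc i) - eps)"
  proof (cases "Suc i < n")
    case False
    then have "Suc i = n"
      using assms(3) by simp
    then show ?thesis
      using assms(1) pt_add_2pi[of "e 0 - eps"] by (simp add: cuts_def corner_def algebra_simps)
  qed (simp add: corner_def)
  then show ?thesis
    using assms cuts_step[OF assms(1,3,2)]
    by (simp add: side_def corner_def open_arc_pt)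
qed

text \<open>Shifting both ends of a block back by \<open>eps\<close> does not change which endpoints
  it contains.\<close>

lemma pt_in_side:
  assumes "cuts n e" "2 \<le> n" "i < n" "endpt t" "e i \<le> t" "t < e (Suc i)"
  shows "pt t \<in> side n (corner e) i"
proof -
  have "endpt (e (Suc i))"
    using assms(1,3) by (auto simp: cuts_def)
  then have "t < e (Suc i) - eps"
    using assms by (intro eps_gap)
  then show ?thesis
    using assms eps_pos by (auto simp: side_corner)
qed

lemma in_corner_pt:
  assumes "cuts n e" "2 \<le> n" "0 < i" "i < n" "endpt s" "e (i - 1) \<le> s" "s < e i"
  shows "in_corner n (corner e) i {pt s, pt (e i)}"
proof -
  have "i + n - 1 = (i - 1) + n" "(i - 1) + n + 1 = (i - 1 + 1) + n"
    using assms(3) by simp_all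
  then have "side n (corner e) (i + n - 1) = side n (corner e) (i - 1)"
    unfolding side_def by (simp only: mod_add_self2)
  moreover have "pt s \<in> side n (corner e) (i - 1)"
    using assms by (intro pt_in_side) auto
  moreover have "pt (e i) \<in> side n (corner e) i"
    using assms(1,4) by (intro pt_in_side[OF assms(1,2)]) (auto simp: cuts_def)
  ultimately show ?thesis
    unfolding in_corner_def by blast
qed

lemma in_corner_0_pt:
  assumes "cuts n e" "2 \<le> n" "endpt s" "e (n - 1) \<le> s" "s < e n"
  shows "in_corner n (corner e) 0 {pt s, pt (e 0)}"
proof -
  have "pt s \<in> side n (corner e) (n - 1)"
    using assms by (intro pt_in_side) auto
  moreover have "pt (e 0) \<in> side n (corner e) 0"
    using assms(1,2) by (intro pt_in_side[OF assms(1,2)]) (auto simp: cuts_def)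
  ultimately show ?thesis
    unfolding in_corner_def by auto
qed

text \<open>No endpoint lies between a corner and the cut directly after it, by the choice of
  \<open>eps\<close>.\<close>

lemma close_chord_corner:
  assumes "cuts n e" "2 \<le> n" "i < n" "c \<in> C" "pt (e i) \<in> c"
  shows "close_chord C n (corner e) i c"
proof -
  have e: "endpt (e i)" "e i < e (Suc i)"
    using assms(1,3) by (auto simp: cuts_def)
  have "pt (e i) \<in> side n (corner e) i"
    using e assms by (intro pt_in_side) auto
  moreover have "\<Union>C \<inter> open_arc (pt (e i - eps)) (pt (e i)) = {}"
    using eps_pos eps_less eps_gap[OF _ e(1)] by (force simp: open_arc_pt endpt_def)
  ultimately show ?thesis
    unfolding close_chord_def close_on_side_def
    using assms(3-5) by (intro conjI bexI[of _ "pt (e i)"]) (auto simp: side_def corner_def)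
qed

section \<open>Greedy placement of corners\<close>

text \<open>The cuts follow the orbit of \<open>x\<close> as long as it stays within the turn,
  framed by \<open>e\<close> and \<open>e + 2 * pi\<close>. An arc starting strictly after an orbit
  point ends no earlier than the next one, by minimality of \<open>nxt\<close>; only an arc starting
  exactly at a cut needs a separate argument.\<close>

lemma greedy_cuts:
  assumes e: "endpt e" and x: "x = e - eps"
    and j: "orbit x j < x + 2 * pi" "x + 2 * pi \<le> orbit x (Suc j)"
  defines "f \<equiv> \<lambda>i. if i = 0 then e else if i \<le> j then orbit x i else e + 2 * pi"
  shows "cuts (Suc j) f"
proof -
  \<comment> \<open>Because \<open>x\<close> is only \<open>eps\<close> before \<open>e\<close>, an
    endpoint beyond \<open>x + 2 * pi\<close> is already at \<open>e + 2 * pi\<close> or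
    later.\<close>
  have last: "e + 2 * pi \<le> t" if "endpt t" "x + 2 * pi \<le> t" for t
    by (rule endpt_ge) (use that e in \<open>auto simp: x\<close>)
  have first: "e \<le> t" if "endpt t" "x < t" for t
    by (rule endpt_ge) (use that e in \<open>auto simp: x\<close>)
  have f_end: "endpt (f i)" for i
    using e by (auto simp: f_def endpt_orbit)
  have step: "f (Suc i) \<le> t" if "chord_arc s t" "orbit x i < s" "i \<le> j" for i s t
  proof -
    have "orbit x (Suc i) \<le> t"
      using nxt_le that by simp
    then show ?thesis
      using that j(2) arcD(5)[OF that(1)] last by (cases "i < j") (auto simp: f_def)
  qed
  have cut: "f (Suc i) \<le> t" if "i \<le> j" "chord_arc s t" "f i \<le> s" for i s t
  proof (cases "orbit x i < s")
    case True
    then show ?thesis using step that by blast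
  next
    case False
    have "i \<noteq> 0"
      using False that(3) eps_pos by (auto simp: f_def x intro: ccontr)
    then have s: "s = orbit x i"
      using False that(1,3) by (auto simp: f_def)
    obtain i' where i': "i = Suc i'"
      using \<open>i \<noteq> 0\<close> not0_implies_Suc by blast
    \<comment> \<open>The arc from \<open>s\<close> is the other side of the chord completed at
      \<open>orbit x i\<close>, so it ends a turn after the opening point \<open>r\<close> of that
      chord, past all cuts.\<close>
    obtain r where r: "orbit x i' < r" "chord_arc r (orbit x i)"
      using orbit_arc[of x i'] i' by auto
    have "t = r + 2 * pi"
      using arc_arc r(2) that(2) s by blast
    moreover have "x < r"
      using r(1) orbit_mono[of 0 i' x] by simp
    ultimately have "e + 2 * pi \<le> t"
      using first arcD(4)[OF r(2)] by simp
    moreover have "f (Suc i) \<le> e + 2 * pi"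
    proof (cases "Suc i \<le> j")
      case True
      then have "orbit x (Suc i) \<le> orbit x j"
        by (rule orbit_mono)
      then show ?thesis
        using True j(1) eps_pos by (auto simp: f_def x)
    qed (simp add: f_def)
    ultimately show ?thesis by simp
  qed
  have "f i < f (Suc i)" if "i \<le> j" for i
  proof -
    obtain s where s: "orbit x i < s" "chord_arc s (orbit x (Suc i))"
      by (rule orbit_arc)
    have "f i < orbit x (Suc i)"
    proof (cases "i = 0")
      case True
      then show ?thesis
        using first[of s] s arcD[OF s(2)] by (auto simp: f_def)
    next
      case False
      then show ?thesis
        using that by (simp add: f_def nxt_greater)
    qed
    moreover have "f i < e + 2 * pi"
      using that j(1) orbit_mono[of i j x] eps_pos by (auto simp: f_def x)
    ultimately show ?thesis
      by (auto simp: f_def)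
  qed
  then show ?thesis
    using cut f_end by (auto simp: cuts_def less_Suc_eq_le) (simp add: f_def)
qed

lemma ex_greedy_cuts:
  assumes "endpt e" "x = e - eps"
  obtains j where "orbit x j < x + 2 * pi" "x + 2 * pi \<le> orbit x (Suc j)"
    "cuts (Suc j) (\<lambda>i. if i = 0 then e else if i \<le> j then orbit x i else e + 2 * pi)"
proof -
  have "x < x + 2 * pi"
    by simp
  then obtain j where j: "orbit x j < x + 2 * pi" "x + 2 * pi \<le> orbit x (Suc j)"
    using orbit_exceeds by blast
  show ?thesis
    by (rule that[OF j greedy_cuts[OF assms j]])
qed

section \<open>Minimum corner sets and the length of greedy orbits\<close>

lemma psi_r_least: "satisfying_corners C S \<Longrightarrow> psi_r C \<le> card S"
  unfolding psi_r_def by (rule Least_le) auto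

text \<open>The greedy placement supplies some satisfying set, so the \<open>LEAST\<close> is over a
  nonempty set.\<close>

lemma psi_r_attained:
  obtains S where "satisfying_corners C S" "card S = psi_r C"
proof -
  obtain e where "endpt e"
    by (rule ex_endpt)
  then obtain n f where "cuts n f"
    using ex_greedy_cuts[OF _ refl] by blast
  then have "\<exists>k S. satisfying_corners C S \<and> card S = k"
    using cuts_satisfying(1) by blast
  then have "\<exists>S. satisfying_corners C S \<and> card S = psi_r C"
    unfolding psi_r_def by (rule LeastI_ex)
  then show ?thesis
    using that by blast
qed

lemma ex_corner_after:
  assumes "satisfying_corners C S"
  obtains x where "y \<le> x" "x < y + 2 * pi" "pt x \<in> S" "\<not> endpt x"
proof -
  obtain e where "endpt e"
    by (rule ex_endpt)
  then obtain t where t: "chord_arc e t"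
    by (rule ex_arc_from)
  then have "pt e \<noteq> pt t"
    using pt_inj[of e t e] arcD[OF t] by auto
  then have "S \<inter> open_arc (pt e) (pt t) \<noteq> {}"
    using assms arcD(3)[OF t] by (auto simp: satisfying_corners_def satisfied_def)
  then obtain z where "z \<in> S" by auto
  then have "z \<in> circle" "z \<notin> \<Union>C"
    using assms by (auto simp: satisfying_corners_def)
  moreover obtain x where "y \<le> x" "x < y + 2 * pi" "z = pt x"
    using lift_circle[OF calculation(1)] .
  ultimately show ?thesis
    using that \<open>z \<in> S\<close> by (auto simp: endpt_def)
qed

text \<open>Starting from a corner, some chord is completed before the turn ends, so the first
  iterate stays within the turn and \<open>orbit_less_card\<close> applies with
  \<open>j = 1\<close>.\<close>

lemma psi_r_ge_2: "2 \<le> psi_r C"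
proof -
  obtain S where S: "satisfying_corners C S" "card S = psi_r C"
    by (rule psi_r_attained)
  obtain x where x: "pt x \<in> S" "\<not> endpt x"
    using ex_corner_after[OF S(1), of 0] by metis
  obtain c where "c \<in> C"
    using C_nonempty by auto
  then obtain s t where "x < s" "t < x + 2 * pi" "chord_arc s t"
    using chord_lift[OF _ x(2)] by metis
  then have "orbit x 1 < x + 2 * pi"
    using nxt_le[of x s t] by simp
  then show ?thesis
    using orbit_less_card[OF S(1) x(1)] S(2) by fastforce
qed

text \<open>A corner of a minimum set, lifted to the turn before \<open>y\<close>, serves as
  \<open>x\<close>: by \<open>orbit_less_card\<close>, \<open>psi_r C\<close> iterations cannot stay
  within one turn. This is the lower end needed by \<open>periodic_orbit\<close>.\<close>

lemma psi_r_orbit: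
  obtains x where "x < y" "x + 2 * pi \<le> orbit x (psi_r C)"
proof -
  obtain S where S: "satisfying_corners C S" "card S = psi_r C"
    by (rule psi_r_attained)
  obtain x where x: "x < y" "pt x \<in> S"
    using ex_corner_after[OF S(1), of "y - 2 * pi"] by auto
  then show ?thesis
    using that[of x] orbit_less_card[OF S(1) x(2), of "psi_r C"] S(2) by fastforce
qed

section \<open>Orbits closing after one turn: alternative (a)\<close>

lemma periodic_orbit_cuts:
  assumes "endpt e" "orbit e k = e + 2 * pi" "2 \<le> k"
  shows "cuts k (orbit e)"
proof -
  have cut: "orbit e (Suc i) \<le> t" if "i < k" "chord_arc s t" "orbit e i \<le> s" for i s t
  proof (cases "orbit e i < s")
    case True
    then show ?thesis
      using nxt_le that(2) by simp
  next
    case False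
    then have s: "s = orbit e i"
      using that(3) by simp
    show ?thesis
    proof (cases i)
      case 0
      \<comment> \<open>The chord at \<open>e\<close> is the one completed by the last iteration.
        Its arc from \<open>e\<close> therefore ends at the opening point \<open>r\<close>, which
        lies beyond \<open>orbit e (k - 1)\<close> and so beyond the first iterate.\<close>
      obtain r where r: "orbit e (k - 1) < r" "chord_arc r (orbit e (Suc (k - 1)))"
        by (rule orbit_arc)
      then have "chord_arc r (e + 2 * pi)"
        using assms(2,3) by simp
      moreover have "chord_arc (e + 2 * pi) (t + 2 * pi)"
        using arc_shift that(2) s 0 by simp
      ultimately have "t = r"
        using arc_arc by fastforce
      moreover have "orbit e (Suc i) \<le> orbit e (k - 1)"
        using 0 assms(3) by (intro orbit_mono) auto
      ultimately show ?thesis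
        using r(1) by simp
    next
      case (Suc i')
      obtain r where r: "orbit e i' < r" "chord_arc r (orbit e i)"
        using orbit_arc[of e i'] Suc by auto
      have "t = r + 2 * pi"
        using arc_arc r(2) that(2) s by blast
      moreover have "e < r"
        using r(1) orbit_mono[of 0 i' e] by simp
      moreover have "orbit e (Suc i) \<le> orbit e k"
        using that(1) by (intro orbit_mono) auto
      ultimately show ?thesis
        using assms(2) by linarith
    qed
  qed
  have "endpt (orbit e i)" for i
    using assms(1) endpt_orbit by (cases "i = 0") auto
  then show ?thesis
    using cut assms(2) by (auto simp: cuts_def nxt_greater simp del: orbit_Suc)
       (simp add: nxt_greater)
qed

text \<open>The chord completed at a cut was opened in the block just before it, so it lies in the
  corner there; since the orbit closes up, this also holds at \<open>\<tau> 0\<close>.\<close>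

lemma corners_periodic:
  assumes "endpt e" "orbit e k = e + 2 * pi" "2 \<le> k"
  shows "\<exists>\<tau> c. clockwise_corners k \<tau> \<and> satisfying_corners C (\<tau> ` {..<k}) \<and>
    (\<forall>i<k. close_chord C k \<tau> i (c i)) \<and> (\<forall>i<k. in_corner k \<tau> i (c i)) \<and>
    independent_in_series (map c [0..<k])"
proof -
  let ?o = "orbit e"
  have cuts: "cuts k ?o"
    by (rule periodic_orbit_cuts[OF assms])
  have "\<exists>s. ?o i < s \<and> chord_arc s (?o (Suc i))" for i
    using orbit_arc[of e i] by metis
  then obtain s where s: "\<And>i. ?o i < s i" "\<And>i. chord_arc (s i) (?o (Suc i))"
    by metis
  \<comment> \<open>The chord for index 0 is completed by the last iteration at
    \<open>e + 2 * pi\<close>; its opening point is moved back one turn to match \<open>e\<close>.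
    The window for the series starts at this point.\<close>
  define s' where "s' i = (if i = 0 then s (k - 1) - 2 * pi else s (i - 1))" for i
  define c where "c i = {pt (s' i), pt (?o i)}" for i
  have Suc_k: "Suc (k - 1) = k"
    using assms(3) by simp
  have chord_arc: "chord_arc (s' i) (?o i)" for i
  proof (cases i)
    case 0
    then show ?thesis
      using arc_shift'[OF s(2)[of "k - 1"]] assms(2) Suc_k by (simp add: s'_def del: orbit_Suc)
  next
    case (Suc i')
    then show ?thesis
      using s(2)[of i'] by (simp add: s'_def)
  qed
  have in_c: "in_corner k (corner ?o) i (c i)" if "i < k" for i
  proof (cases "i = 0")
    case True
    have "in_corner k (corner ?o) 0 {pt (s (k - 1)), pt (?o 0)}"
      using s[of "k - 1"] arcD[OF s(2)[of "k - 1"]] assms(3) Suc_k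
      by (intro in_corner_0_pt[OF cuts]) (simp_all del: orbit_Suc)
    then show ?thesis
      using True by (simp add: c_def s'_def)
  next
    case False
    then have "s' i = s (i - 1)" "Suc (i - 1) = i"
      by (simp_all add: s'_def)
    then show ?thesis
      unfolding c_def using False that s(1)[of "i - 1"] arcD[OF chord_arc[of i]]
      by (intro in_corner_pt[OF cuts assms(3)]) auto
  qed
  have close: "close_chord C k (corner ?o) i (c i)" if "i < k" for i
    using arcD(3)[OF chord_arc[of i]] that
    by (intro close_chord_corner[OF cuts assms(3)]) (auto simp: c_def)
  have "independent_in_series (map c [0..<k])"
  proof (rule independent_in_series_pt[where s = s' and t = ?o and y = "s' 0"])
    show "s' 0 \<le> s' i \<and> s' i < ?o i \<and> ?o i < s' 0 + 2 * pi" if "i < k" for i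
    proof (intro conjI)
      show "s' i < ?o i"
        using arcD(1)[OF chord_arc] .
      have "?o i \<le> ?o (k - 1)"
        using that by (intro orbit_mono) auto
      then show "?o i < s' 0 + 2 * pi"
        using s(1)[of "k - 1"] by (simp add: s'_def)
      show "s' 0 \<le> s' i"
      proof (cases "i = 0")
        case False
        have "s' 0 < e"
          using arcD(1)[OF chord_arc[of 0]] by simp
        moreover have "e \<le> ?o (i - 1)"
          using orbit_mono[of 0 "i - 1" e] by simp
        ultimately show ?thesis
          using s(1)[of "i - 1"] False by (auto simp: s'_def)
      qed simp
    qed
    show "?o i < s' (Suc i)" for i
      using s(1) by (simp add: s'_def)
  qed (use assms(3) in \<open>auto simp: c_def\<close>)
  then show ?thesis
    using cuts_clockwise[OF cuts] cuts_satisfying(1)[OF cuts] close in_c by blast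
qed

section \<open>Orbits always exceeding one turn: alternative (b)\<close>

lemma clique_of_long_orbits:
  assumes long: "\<And>y. y + 2 * pi < orbit y 2"
    and "c \<in> C" "d \<in> C" "c \<noteq> d"
  shows "chords_intersect c d"
proof -
  obtain e where "endpt e"
    by (rule ex_endpt)
  then have x: "\<not> endpt (e - eps)"
    by (rule not_endpt_before)
  \<comment> \<open>Two arcs in series within a turn would be completed by two iterations started at
    the end of the second arc, one turn earlier.\<close>
  have series: False if "chord_arc s t" "chord_arc s' t'" "t < s'" "t' < s + 2 * pi" for s t s' t'
  proof -
    have "nxt (t' - 2 * pi) \<le> t"
      using that by (intro nxt_le[of _ s]) auto
    then have "nxt (nxt (t' - 2 * pi)) \<le> t'"
      using that by (intro nxt_le[of _ s']) auto
    then show False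
      using long[of "t' - 2 * pi"] by (simp add: numeral_2_eq_2)
  qed
  have *: "chords_intersect c d"
    if c: "c \<in> C" "c = {pt s, pt t}" "chord_arc s t" "t < e - eps + 2 * pi"
      and d: "d \<in> C" "d = {pt s', pt t'}" "chord_arc s' t'" "t' < e - eps + 2 * pi"
      and "c \<noteq> d" "s < s'" "e - eps < s" for c d s t s' t'
  proof -
    have "s' \<noteq> t" "t \<noteq> t'"
      using chord_eqI[OF c(1) d(1), of "pt t"] c(2) d(2) \<open>c \<noteq> d\<close> by auto
    moreover have "\<not> t < s'"
      using series[OF c(3) d(3)] d(4) \<open>e - eps < s\<close> by auto
    \<comment> \<open>If the second chord were nested in the arc of the first, it would be in series
      with the other arc of the first.\<close>
    moreover have "\<not> t' < t"
      using series[OF d(3) arc_flip[OF c(3)]] \<open>s < s'\<close> by auto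
    ultimately show ?thesis
      unfolding c(2) d(2) using that by (intro chords_intersect_crossing) auto
  qed
  obtain s t where c: "e - eps < s" "t < e - eps + 2 * pi" "c = {pt s, pt t}" "chord_arc s t"
    using chord_lift[OF assms(2) x] by metis
  obtain s' t' where d: "e - eps < s'" "t' < e - eps + 2 * pi" "d = {pt s', pt t'}" "chord_arc s' t'"
    using chord_lift[OF assms(3) x] by metis
  have "s \<noteq> s'"
    using chord_eqI[OF assms(2,3), of "pt s"] assms(4) c(3) d(3) by auto
  then consider "s < s'" | "s' < s" by linarith
  then show ?thesis
  proof cases
    case 1
    then show ?thesis
      using *[OF assms(2) c(3,4,2) assms(3) d(3,4,2)] assms(4) c(1) by blast
  next
    case 2
    then have "chords_intersect d c"
      using *[OF assms(3) d(3,4,2) assms(2) c(3,4,2)] assms(4) d(1) by blast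
    then show ?thesis
      by (simp add: chords_intersect_def Int_commute)
  qed
qed

text \<open>Long orbits allow at most \<open>k\<close> greedy corners and \<open>psi_r\<close>
  requires at least \<open>k\<close>, so the cuts after \<open>e\<close> are exactly the first
  \<open>k - 1\<close> iterates, and each of these completes a chord in its corner.\<close>

lemma corners_long:
  assumes long: "\<And>y. y + 2 * pi < orbit y k" and k: "psi_r C = k"
  shows "\<exists>\<tau> c. clockwise_corners k \<tau> \<and> satisfying_corners C (\<tau> ` {..<k}) \<and>
    (\<forall>i<k. close_chord C k \<tau> i (c i)) \<and> (\<forall>i\<in>{1..k - 1}. in_corner k \<tau> i (c i)) \<and>
    independent_in_series (map c [1..<k]) \<and>
    (k > 2 \<longrightarrow> (\<forall>d\<in>C. in_corner k \<tau> 0 d \<longrightarrow>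
      chords_intersect d (c 1) \<and> \<not> chords_intersect d (c (k - 1))))"
proof -
  have k2: "2 \<le> k"
    using psi_r_ge_2 k by simp
  obtain e where e: "endpt e"
    by (rule ex_endpt)
  define x where "x = e - eps"
  let ?o = "orbit x"
  obtain j where j: "?o j < x + 2 * pi"
    and "cuts (Suc j) (\<lambda>i. if i = 0 then e else if i \<le> j then ?o i else e + 2 * pi)"
    using ex_greedy_cuts[OF e x_def] .
  define f where "f = (\<lambda>i. if i = 0 then e else if i \<le> j then ?o i else e + 2 * pi)"
  have cuts: "cuts (Suc j) f"
    unfolding f_def by fact
  have "j < k"
    using orbit_mono[of k j x] long[of x] j by force
  moreover have "k \<le> Suc j"
    using psi_r_least[OF cuts_satisfying(1)[OF cuts]] cuts_satisfying(2)[OF cuts] k by simp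
  ultimately have Suc_j: "Suc j = k"
    by simp
  have cuts: "cuts k f"
    using cuts Suc_j by simp
  have f: "f i = ?o i" if "0 < i" "i < k" for i
    using that Suc_j by (simp add: f_def)
  have f_0: "f 0 = e"
    by (simp add: f_def)
  have o_less: "?o i < x + 2 * pi" if "i < k" for i
    using orbit_mono[of i j x] j that Suc_j by simp
  have "\<exists>s. ?o i < s \<and> chord_arc s (?o (Suc i))" for i
    using orbit_arc[of x i] by metis
  then obtain r where r: "\<And>i. ?o i < r i" "\<And>i. chord_arc (r i) (?o (Suc i))"
    by metis
  define s where "s i = r (i - 1)" for i
  have s: "?o (i - 1) < s i" "chord_arc (s i) (?o i)" if "0 < i" for i
    using r[of "i - 1"] that by (auto simp: s_def simp del: orbit_Suc)
  \<comment> \<open>At \<open>e\<close> no chord has been completed by the orbit, so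
    \<open>c 0\<close> is simply the chord with endpoint \<open>e\<close>.\<close>
  obtain c\<^sub>0 where c\<^sub>0: "c\<^sub>0 \<in> C" "pt e \<in> c\<^sub>0"
    using e by (auto simp: endpt_def)
  define c where "c i = (if i = 0 then c\<^sub>0 else {pt (s i), pt (?o i)})" for i
  have c: "c i = {pt (s i), pt (?o i)}" if "0 < i" for i
    using that by (simp add: c_def)
  have x_less: "x < s i" if "0 < i" for i
    using s(1)[OF that] orbit_mono[of 0 "i - 1" x] by simp
  \<comment> \<open>For \<open>i = 1\<close> the block starts at \<open>e\<close>, slightly after
    the orbit's start \<open>x\<close>; no endpoint lies between them.\<close>
  have f_s: "f (i - 1) \<le> s i" if "0 < i" "i < k" for i
  proof (cases "i = 1")
    case True
    then show ?thesis
      using endpt_ge[OF arcD(4)[OF s(2)[of i]] e] x_less[of i] by (simp add: f_0 x_def)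
  next
    case False
    then show ?thesis
      using f[of "i - 1"] s(1)[of i] that by simp
  qed
  have in_c: "in_corner k (corner f) i (c i)" if "i \<in> {1..k - 1}" for i
  proof -
    have i: "0 < i" "i < k"
      using that k2 by auto
    have "in_corner k (corner f) i {pt (s i), pt (f i)}"
      using i f_s[OF i] f[OF i] arcD[OF s(2)[OF i(1)]]
      by (intro in_corner_pt[OF cuts k2]) auto
    then show ?thesis
      using i by (simp add: c f)
  qed
  have close: "close_chord C k (corner f) i (c i)" if "i < k" for i
    using that c\<^sub>0 arcD(3)[OF s(2)[of i]]
    by (intro close_chord_corner[OF cuts k2]) (auto simp: c_def f f_0)
  have series: "independent_in_series (map c [1..<k])"
  proof (rule independent_in_series_pt[where s = s and t = ?o and y = x])
    fix i assume i: "1 \<le> i" "i < k"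
    then show "x \<le> s i \<and> s i < ?o i \<and> ?o i < x + 2 * pi"
      using x_less[of i] arcD(1)[OF s(2)[of i]] o_less[of i] by auto
  next
    fix i assume "1 \<le> i" "Suc i < k"
    then show "?o i < s (Suc i)"
      using s(1)[of "Suc i"] by simp
  qed (use k2 in \<open>auto simp: c\<close>)
  \<comment> \<open>A chord in \<open>\<tau> 0\<close> has an end \<open>u\<close> on the last side
    and an end \<open>v\<close> on the first. It is shown that \<open>u\<close> comes after
    \<open>c (k - 1)\<close> is completed and that \<open>v\<close> lies strictly between the ends
    of \<open>c 1\<close>.\<close>
  have crossing: "chords_intersect d (c 1) \<and> \<not> chords_intersect d (c (k - 1))"
    if k3: "k > 2" and d: "d \<in> C" "in_corner k (corner f) 0 d" for d
  proof -
    have k1: "0 < k - 1" "k - 1 < k" "Suc (k - 1) = k" "Suc (k - 2) = k - 1"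
      using k3 by simp_all
    obtain p q where pq: "d = {p, q}" "p \<in> side k (corner f) (k - 1)" "q \<in> side k (corner f) 0"
      using d(2) by (auto simp: in_corner_def)
    have f_k: "f k = e + 2 * pi"
      using cuts f_0 by (simp add: cuts_def)
    obtain u where u: "f (k - 1) - eps < u" "u < x + 2 * pi" "p = pt u"
      using pq(2) k1 f_k by (auto simp: side_corner[OF cuts k2] x_def)
    obtain v where v: "x < v" "v < f 1 - eps" "q = pt v"
      using pq(3) k2 f_0 by (auto simp: side_corner[OF cuts k2] x_def)
    have uv: "endpt u" "endpt v"
      using d(1) pq(1) u(3) v(3) by (auto simp: endpt_def)
    have o1: "f 1 = ?o 1" "f (k - 1) = ?o (k - 1)"
      using f[of 1] f[of "k - 1"] k1 k2 by simp_all
    have v1: "v < ?o 1"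
      using v(2) o1 eps_pos by simp
    have "?o 1 \<le> ?o (k - 2)" "?o (k - 2) < ?o (k - 1)"
      using k3 by (auto intro: orbit_mono orbit_strict_mono simp del: orbit_Suc)
    note o2 = this
    have s_k: "?o (k - 2) < s (k - 1)" "chord_arc (s (k - 1)) (?o (k - 1))"
      using s[OF k1(1)] by (simp_all add: numeral_2_eq_2)
    have s_1: "x < s 1" "chord_arc (s 1) (?o 1)"
      using s[of 1] by simp_all
    have "?o (k - 1) \<le> u"
      by (rule endpt_ge) (use u(1) o1 uv(1) endpt_orbit[OF k1(1)] in auto)
    moreover have "u \<noteq> ?o (k - 1)"
    proof
      assume "u = ?o (k - 1)"
      then have "d = c (k - 1)"
        using arcD(3)[OF s_k(2)] d(1) pq(1) u(3) k1(1)
        by (intro chord_eqI[of _ _ "pt u"]) (auto simp: c)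
      moreover have "pt v \<noteq> pt (s (k - 1))"
      proof
        assume "pt v = pt (s (k - 1))"
        then have "v = s (k - 1)"
          using arcD(1)[OF s_k(2)] x_less[OF k1(1)] o_less[OF k1(2)] v v1 o2
          by (intro pt_inj[of _ _ x]) auto
        then show False
          using v1 o2 s_k by simp
      qed
      moreover have "pt v \<noteq> pt u"
        using chords[OF d(1)] pq(1) u(3) v(3) by (auto simp: is_chord_def)
      ultimately show False
        using \<open>u = ?o (k - 1)\<close> pq(1) v(3) c[OF k1(1)] by auto
    qed
    ultimately have u1: "?o (k - 1) < u" by simp
    have arc_d: "chord_arc u (v + 2 * pi)"
      using u v v1 o2 u1 d(1) pq(1) by (auto simp: chord_arc_def)
    \<comment> \<open>Otherwise \<open>c 1\<close>, ..., \<open>c (k - 1)\<close> and then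
      \<open>d\<close> would be in series within the turn starting at \<open>v\<close>, so
      \<open>k\<close> iterations from \<open>v\<close> would take at most a turn.\<close>
    have "\<not> v < s 1"
    proof
      assume "v < s 1"
      then have "nxt v \<le> ?o 1"
        using s_1 by (intro nxt_le) auto
      then have "orbit (nxt v) (k - 2) \<le> orbit (?o 1) (k - 2)"
        by (rule orbit_mono_start)
      then have "orbit v (k - 1) \<le> ?o (k - 1)"
        using orbit_add[of v 1 "k - 2"] orbit_add[of x 1 "k - 2"] k1(4) by simp
      then have "orbit v (Suc (k - 1)) \<le> v + 2 * pi"
        using nxt_le[OF _ arc_d] u1 by simp
      then show False
        using long[of v] k1(3) by simp
    qed
    moreover have "v \<noteq> s 1"
    proof
      assume "v = s 1"
      then have "d = c 1"
        using arcD(3)[OF s_1(2)] d(1) pq(1) v(3)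
        by (intro chord_eqI[of _ _ "pt v"]) (auto simp: c)
      moreover have "pt u \<noteq> pt v"
        using chords[OF d(1)] pq(1) u(3) v(3) by (auto simp: is_chord_def)
      ultimately have "pt u = pt (?o 1)"
        using pq(1) u(3) v(3) c[of 1] \<open>v = s 1\<close> by (auto simp: doubleton_eq_iff)
      then have "u = ?o 1"
        using u v v1 o2 u1 by (intro pt_inj[of _ _ x]) auto
      then show False
        using u1 o2 by simp
    qed
    ultimately have v2: "s 1 < v" by simp
    \<comment> \<open>With \<open>u\<close> moved back a turn, the ends of \<open>d\<close> and
      \<open>c 1\<close> alternate. The chord \<open>c (k - 1)\<close> lies entirely between
      \<open>v\<close> and \<open>u\<close>, since \<open>k > 2\<close> puts its opening after the
      first iterate.\<close>
    have "chords_intersect {pt (u - 2 * pi), pt v} {pt (s 1), pt (?o 1)}"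
      using u(2) s_1 v2 v1 o2 u1 by (intro chords_intersect_crossing) auto
    moreover have "\<not> chords_intersect {pt (s (k - 1)), pt (?o (k - 1))} {pt u, pt (v + 2 * pi)}"
      using arcD[OF s_k(2)] arcD[OF arc_d] u1 v1 o2 s_k by (intro not_chords_intersect) auto
    ultimately show ?thesis
      using pq(1) u(3) v(3) k1(1) by (auto simp: c chords_intersect_def Int_commute)
  qed
  show ?thesis
    using cuts_clockwise[OF cuts] cuts_satisfying(1)[OF cuts] close in_c series crossing
    by blast
qed

end

section \<open>The empty representation and the theorem\<close>

text \<open>This excludes \<open>C = {}\<close> in the theorem: there \<open>psi_r C\<close> is
  \<open>0\<close>, whereas this witness makes the \<open>LEAST\<close> in \<open>psi G\<close>
  attained and so at least \<open>2\<close>.\<close>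

lemma ex_polygon_representation_empty:
  assumes "circle_representation {} G"
  shows "polygon_representation 2 {} {1, -1} G"
  using assms by (auto simp: polygon_representation_def satisfying_corners_def)

theorem theorem3:
  fixes G :: "'v pair_pre_digraph" and C :: "complex set set" and k :: nat
  assumes "pair_graph G"
    and "circle_representation C G"
    and "psi_r C = k"
    and "psi G = k"
  shows "(\<exists>cs. set cs \<subseteq> C \<and> length cs = k - 1 \<and> independent_in_series cs) \<and>
    (\<exists>\<tau> c. clockwise_corners k \<tau> \<and> satisfying_corners C (\<tau> ` {..<k}) \<and>
      (\<forall>i<k. close_chord C k \<tau> i (c i)) \<and>
      (\<forall>i\<in>{1..k - 1}. in_corner k \<tau> i (c i)) \<and>
      ((in_corner k \<tau> 0 (c 0) \<and> independent_in_series (map c [0..<k])) \<or>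
       (independent_in_series (map c [1..<k]) \<and>
        (if k > 2
         then \<forall>d\<in>C. in_corner k \<tau> 0 d \<longrightarrow>
                chords_intersect d (c 1) \<and> \<not> chords_intersect d (c (k - 1))
         else complete_digraph (card (pverts G)) (with_proj G)))))"
    (is "?series \<and> ?corners")
proof -
  interpret pair_graph G by fact
  obtain h where h: "bij_betw h (pverts G) C"
    "\<And>u v. u \<in> pverts G \<Longrightarrow> v \<in> pverts G \<Longrightarrow> u \<noteq> v \<Longrightarrow>
      (u, v) \<in> parcs G \<longleftrightarrow> chords_intersect (h u) (h v)"
    using assms(2) by (auto simp: circle_representation_def)
  have "C \<noteq> {}"
  proof
    assume "C = {}"
    then have "psi_r C = 0"
      unfolding psi_r_def
      by (intro Least_equality) (auto simp: satisfying_corners_def intro!: exI[of _ "{}"])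
    moreover have "2 \<le> psi G"
      using ex_polygon_representation_empty[of G] assms(2) \<open>C = {}\<close>
        LeastI[of "\<lambda>k. 2 \<le> k \<and> (\<exists>C S. polygon_representation k C S G)" 2]
      unfolding psi_def by auto
    ultimately show False
      using assms(3,4) by simp
  qed
  moreover have "finite C"
    using h(1) pair_finite_verts bij_betw_finite by blast
  ultimately interpret chord_family C
    using assms(2) by unfold_locales (auto simp: circle_representation_def)
  have k2: "2 \<le> k"
    using psi_r_ge_2 assms(3) by simp
  show ?thesis
  proof (cases "\<exists>y. orbit y k \<le> y + 2 * pi")
    case True
    then obtain y where y: "orbit y k \<le> y + 2 * pi" by blast
    \<comment> \<open>The orbit from \<open>x\<close> takes at least a turn and the one from
      \<open>y\<close> at most a turn, so an orbit closing up exactly exists between them.\<close>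
    obtain x where "x < y" "x + 2 * pi \<le> orbit x k"
      using psi_r_orbit[of y] assms(3) by auto
    then obtain e where "endpt e" "orbit e k = e + 2 * pi"
      using periodic_orbit[of x y k] y k2 by (auto simp: less_imp_le)
    then obtain \<tau> c where \<tau>: "clockwise_corners k \<tau>" "satisfying_corners C (\<tau> ` {..<k})"
      and c: "\<forall>i<k. close_chord C k \<tau> i (c i)" "\<forall>i<k. in_corner k \<tau> i (c i)"
        "independent_in_series (map c [0..<k])"
      using corners_periodic k2 by blast
    \<comment> \<open>All \<open>k\<close> chords are in series here; a prefix provides the required
      \<open>k - 1\<close>.\<close>
    define cs where "cs = take (k - 1) (map c [0..<k])"
    have "independent_in_series cs"
      unfolding cs_def using c(3) k2 by (intro independent_in_series_take) auto
    moreover have "set (map c [0..<k]) \<subseteq> C"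
      using c(1) by (auto simp: close_chord_def)
    then have "set cs \<subseteq> C"
      unfolding cs_def by (rule subset_trans[OF set_take_subset])
    moreover have "length cs = k - 1"
      by (simp add: cs_def)
    ultimately have ?series
      by (intro exI[of _ cs] conjI)
    moreover have "\<forall>i\<in>{1..k - 1}. in_corner k \<tau> i (c i)"
      using c(2) k2 by auto
    moreover have "in_corner k \<tau> 0 (c 0)"
      using c(2) k2 by simp
    ultimately show ?thesis
      using \<tau> c(1,3) by (intro conjI exI[of _ \<tau>] exI[of _ c] disjI1)
  next
    case False
    then have long: "y + 2 * pi < orbit y k" for y
      by (meson not_le)
    obtain \<tau> c where \<tau>: "clockwise_corners k \<tau>" "satisfying_corners C (\<tau> ` {..<k})"
      and c: "\<forall>i<k. close_chord C k \<tau> i (c i)" "\<forall>i\<in>{1..k - 1}. in_corner k \<tau> i (c i)"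
        "independent_in_series (map c [1..<k])"
        "k > 2 \<longrightarrow> (\<forall>d\<in>C. in_corner k \<tau> 0 d \<longrightarrow>
          chords_intersect d (c 1) \<and> \<not> chords_intersect d (c (k - 1)))"
      using corners_long[OF long assms(3)] by blast
    have "set (map c [1..<k]) \<subseteq> C"
      using c(1) by (auto simp: close_chord_def)
    moreover have "length (map c [1..<k]) = k - 1"
      by simp
    ultimately have ?series
      using c(3) by (intro exI[of _ "map c [1..<k]"] conjI)
    have "complete_digraph (card (pverts G)) (with_proj G)" if "\<not> k > 2"
    proof -
      have "k = 2"
        using that k2 by simp
      then have "y + 2 * pi < orbit y 2" for y
        using long[of y] by simp
      note clique = clique_of_long_orbits[OF this]
      have "(u, v) \<in> parcs G" if "u \<in> pverts G" "v \<in> pverts G" "u \<noteq> v" for u v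
      proof -
        have "h u \<in> C" "h v \<in> C" "h u \<noteq> h v"
          using h(1) that by (auto simp: bij_betw_def inj_on_def)
        then show ?thesis
          using h(2)[OF that] clique[of "h u" "h v"] by simp
      qed
      then have "parcs G = {(u, v). (u, v) \<in> pverts G \<times> pverts G \<and> u \<noteq> v}"
        by (auto dest: in_arcsD1 in_arcsD2 pair_no_loops)
      then show ?thesis
        unfolding complete_digraph_pair_def using pair_finite_verts by simp
    qed
    then have "if k > 2
        then \<forall>d\<in>C. in_corner k \<tau> 0 d \<longrightarrow>
               chords_intersect d (c 1) \<and> \<not> chords_intersect d (c (k - 1))
        else complete_digraph (card (pverts G)) (with_proj G)"
      using c(4) by (cases "k > 2") (simp_all only: if_True if_False simp_thms not_False_eq_True)
    with \<tau> c(1-3) have ?corners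
      by (intro exI[of _ \<tau>] exI[of _ c] conjI disjI2)
    with \<open>?series\<close> show ?thesis ..
  qed
qed

end
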